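(* Let $X$ be a finite group, let $E$ be a positive integer such that $x^E=1$ for all $x\in X$, and write $E=2^t\cdot r$ with $t \ge 0$ and $r$ odd. Let $i\in X$ be an involution. Put $D=\{x\in X : i\, i^x \text{ has odd order}\}$ and let $\zeta_1: D\to C_X(i)$ be the map $\zeta_1(x)=(i\, i^x)^{(r+1)/2}\cdot x^{-1}$. Let $x_1,x_2,\ldots$ be independent random elements, each uniformly distributed on $X$, and let $k_1<k_2<\cdots$ be the successive indices $k$ for which $x_k\in D$ (that is, for which $\zeta_1(x_k)$ is defined; almost surely there are infinitely many of them). Then the random elements $\zeta_1(x_{k_1}),\zeta_1(x_{k_2}),\ldots$ are independent and each is uniformly distributed on $C_X(i)$.
   Context: Notation: an involution is an element of order $2$; $i^x=x^{-1}ix$; $C_X(i)$ is the centraliser of $i$ in $X$. The map $\zeta_1$ takes values in $C_X(i)$ on its domain $D$. The identity element has odd order $1$. *)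

theory Defs
  imports "HOL-Algebra.Multiplicative_Group" "HOL-Probability.Probability"
begin

definition involution :: "('a, 'b) monoid_scheme \<Rightarrow> 'a \<Rightarrow> bool" where
  "involution G i \<longleftrightarrow> i \<in> carrier G \<and> group.ord G i = 2"

definition conj_by :: "('a, 'b) monoid_scheme \<Rightarrow> 'a \<Rightarrow> 'a \<Rightarrow> 'a" where
  "conj_by G i x = inv\<^bsub>G\<^esub> x \<otimes>\<^bsub>G\<^esub> i \<otimes>\<^bsub>G\<^esub> x"

definition centraliser :: "('a, 'b) monoid_scheme \<Rightarrow> 'a \<Rightarrow> 'a set" where
  "centraliser G i = {x \<in> carrier G. x \<otimes>\<^bsub>G\<^esub> i = i \<otimes>\<^bsub>G\<^esub> x}"

definition zeta1_dom :: "('a, 'b) monoid_scheme \<Rightarrow> 'a \<Rightarrow> 'a set" where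
  "zeta1_dom G i = {x \<in> carrier G. odd (group.ord G (i \<otimes>\<^bsub>G\<^esub> conj_by G i x))}"

text \<open>The parameter \<open>r\<close> is the odd part of an exponent of the group, so the division by 2 is exact.
  The values are meaningful only for arguments in \<^const>\<open>zeta1_dom\<close>.\<close>

definition zeta1 :: "('a, 'b) monoid_scheme \<Rightarrow> nat \<Rightarrow> 'a \<Rightarrow> 'a \<Rightarrow> 'a" where
  "zeta1 G r i x =
     (i \<otimes>\<^bsub>G\<^esub> conj_by G i x) [^]\<^bsub>G\<^esub> ((r + 1) div 2) \<otimes>\<^bsub>G\<^esub> inv\<^bsub>G\<^esub> x"

text \<open>For a sequence of random elements \<open>X\<close>, the indices \<open>n\<close> at which \<open>X n\<close> lies in the domain
  of \<open>zeta1\<close>. Sequences are indexed from 0, and \<^const>\<open>enumerate\<close> lists an infinite set of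
  naturals in increasing order.\<close>

definition hits :: "('a, 'b) monoid_scheme \<Rightarrow> 'a \<Rightarrow> (nat \<Rightarrow> 'w \<Rightarrow> 'a) \<Rightarrow> 'w \<Rightarrow> nat set" where
  "hits G i X w = {n. X n w \<in> zeta1_dom G i}"

text \<open>The \<open>j\<close>-th output. The successive indices exist only where there are infinitely many hits;
  on the complementary (null) event the output is set to the identity, so that it is
  an everywhere defined random element of the centraliser.\<close>

definition zeta1_output ::
  "('a, 'b) monoid_scheme \<Rightarrow> nat \<Rightarrow> 'a \<Rightarrow> (nat \<Rightarrow> 'w \<Rightarrow> 'a) \<Rightarrow> nat \<Rightarrow> 'w \<Rightarrow> 'a" where
  "zeta1_output G r i X j w =
     (if infinite (hits G i X w) then zeta1 G r i (X (enumerate (hits G i X w) j) w)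
      else \<one>\<^bsub>G\<^esub>)"

end

theory Submission
  imports Defs
begin

text \<open>The involution \<open>i\<close> inverts \<open>y = i i\<^sup>x\<close>. If \<open>y\<close> has odd order then its order divides \<open>r\<close>, so
  \<open>u = y\<^bsup>(r+1)/2\<^esup>\<close> is a square root of \<open>y\<close> and \<open>i\<^sup>u = i y = i\<^sup>x\<close>; hence \<open>u x\<^bsup>-1\<^esup>\<close> centralises \<open>i\<close>.
  For \<open>c\<close> in the centraliser, \<open>i\<^bsup>cx\<^esup> = i\<^sup>x\<close>, so \<open>c x\<close> is mapped to the image of \<open>x\<close> times \<open>c\<^bsup>-1\<^esup>\<close>, and
  all fibres of the map have the same size. It remains to see that sampling an i.i.d. sequence at its
  visits to a set of positive probability gives an i.i.d. sequence with the conditional law: this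
  holds conditionally on each possible set of the first \<open>n\<close> visits, and almost surely
  there are infinitely many visits.\<close>

section \<open>Enumerating initial segments\<close>

text \<open>Truncation keeps the least element as long as something remains. Removing it commutes
  with truncation, so the induction runs over varying \<open>S\<close>.\<close>

lemma enumerate_initial_segment:
  fixes S :: "'a::wellorder set"
  assumes "finite (S \<inter> {..<s})" "n < card (S \<inter> {..<s})"
  shows "enumerate (S \<inter> {..<s}) n = enumerate S n"
  using assms
proof (induction n arbitrary: S)
  case 0
  then obtain y where y: "y \<in> S" "y < s"
    by (metis Int_iff card_gt_0_iff equals0I lessThan_iff)
  then have "(LEAST n. n \<in> S) \<in> S" "(LEAST n. n \<in> S) < s"
    by (auto intro: LeastI le_less_trans[OF Least_le])
  then show ?case
    unfolding enumerate_0 by (intro Least_equality) (auto intro: Least_le)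
next
  case (Suc n)
  let ?a = "LEAST n. n \<in> S"
  obtain y where y: "y \<in> S" "y < s"
    using Suc.prems by (metis Int_iff card.empty equals0I lessThan_iff not_less_zero)
  then have a: "?a \<in> S" "?a < s"
    by (auto intro: LeastI le_less_trans[OF Least_le])
  then have a': "(LEAST n. n \<in> S \<inter> {..<s}) = ?a"
    by (intro Least_equality) (auto intro: Least_le)
  have eq: "S \<inter> {..<s} - {?a} = (S - {?a}) \<inter> {..<s}"
    by auto
  have fin: "finite ((S - {?a}) \<inter> {..<s})"
    using Suc.prems(1) by (auto intro: finite_subset)
  have "card (S \<inter> {..<s}) = Suc (card ((S - {?a}) \<inter> {..<s}))"
    using a Suc.prems(1) by (metis IntI card_Suc_Diff1 eq lessThan_iff)
  with Suc.prems have "n < card ((S - {?a}) \<inter> {..<s})"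
    by simp
  with Suc.IH[OF fin] show ?case
    unfolding enumerate_Suc a' eq by simp
qed

text \<open>For \<open>T\<close> as the set of the first elements of \<open>S\<close>. Membership is
  tested only at positions bounded by an element of \<open>T\<close>; for a finite \<open>T\<close>
  of naturals these are finitely many, which later gives a cylinder event. The union of down-sets
  also makes sense for empty \<open>T\<close>.\<close>

definition initial_segment :: "'a::linorder set \<Rightarrow> 'a set \<Rightarrow> bool" where
  "initial_segment S T \<longleftrightarrow> (\<forall>m \<in> (\<Union>t\<in>T. {..t}). m \<in> S \<longleftrightarrow> m \<in> T)"

text \<open>Two initial segments are comparable: given \<open>a\<close> only in \<open>T\<close> and
  \<open>b\<close> only in \<open>T'\<close>, the smaller of the two lies in \<open>S\<close> and
  below an element of the other segment, hence in that segment. Equal size then forces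
  equality.\<close>

lemma initial_segment_unique:
  assumes "initial_segment S T" "initial_segment S T'" "finite T" "finite T'" "card T = card T'"
  shows "T = T'"
proof -
  have "T \<subseteq> T' \<or> T' \<subseteq> T"
  proof (rule ccontr)
    assume "\<not> (T \<subseteq> T' \<or> T' \<subseteq> T)"
    then obtain a b where ab: "a \<in> T" "a \<notin> T'" "b \<in> T'" "b \<notin> T"
      by auto
    then show False
      using assms(1,2) linear[of a b] unfolding initial_segment_def by auto
  qed
  then show ?thesis
    using assms by (metis card_subset_eq)
qed

lemma enumerate_eq_if_initial_segment:
  fixes S :: "nat set"
  assumes "initial_segment S T" "finite T" "j < card T"
  shows "enumerate S j = enumerate T j"
proof -
  have "T \<noteq> {}"
    using assms by auto
  then have "Max T \<in> T"
    using assms by simp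
  \<comment> \<open>Cutting \<open>S\<close> just after the largest element of \<open>T\<close>
    leaves exactly \<open>T\<close>.\<close>
  with assms have "S \<inter> {..<Suc (Max T)} = T"
    unfolding initial_segment_def using Max_ge[of T]
    by (auto simp: less_Suc_eq_le)
  then show ?thesis
    using enumerate_initial_segment[of S "Suc (Max T)" j] assms by simp
qed

text \<open>Existence to go with uniqueness: an infinite \<open>S\<close> has exactly one initial
  segment of each finite size.\<close>

lemma initial_segment_enumerate:
  fixes S :: "nat set"
  assumes "infinite S"
  shows "initial_segment S (enumerate S ` {..<n})" "card (enumerate S ` {..<n}) = n"
proof -
  show "card (enumerate S ` {..<n}) = n"
    using inj_enumerate[OF assms] by (simp add: card_image inj_on_subset)
  show "initial_segment S (enumerate S ` {..<n})"
    unfolding initial_segment_def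
  proof (intro ballI iffI)
    fix m assume "m \<in> (\<Union>t\<in>enumerate S ` {..<n}. {..t})" and "m \<in> S"
    then obtain j k where "j < n" "m \<le> enumerate S j" "m = enumerate S k"
      using enumerate_Ex[OF assms, of m] by auto
    then show "m \<in> enumerate S ` {..<n}"
      using assms by auto
  qed (auto intro: enumerate_in_set[OF assms])
qed

text \<open>Deleting the least element of a random set gives a random set whose membership events
  are again measurable; hence the induction over all \<open>H\<close>.\<close>

lemma measurable_enumerate:
  fixes H :: "'w \<Rightarrow> nat set"
  assumes "\<And>n. Measurable.pred M (\<lambda>w. n \<in> H w)"
  shows "(\<lambda>w. enumerate (H w) j) \<in> M \<rightarrow>\<^sub>M count_space UNIV"
  using assms
proof (induction j arbitrary: H)
  case 0
  note [measurable] = this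
  show ?case
    unfolding enumerate_0 by measurable
next
  case (Suc j)
  note [measurable] = Suc.prems
  show ?case
    unfolding enumerate_Suc by (rule Suc.IH) simp
qed

section \<open>Subsequences at hitting times of i.i.d. sequences\<close>

text \<open>The default \<open>d\<close> makes the values defined everywhere; with \<open>d\<close>
  in \<open>D\<close> they always lie in \<open>D\<close>.\<close>

definition hit_subsequence ::
  "'a set \<Rightarrow> 'a \<Rightarrow> (nat \<Rightarrow> 'w \<Rightarrow> 'a) \<Rightarrow> nat \<Rightarrow> 'w \<Rightarrow> 'a" where
  "hit_subsequence D d X j w =
     (if infinite {n. X n w \<in> D} then X (enumerate {n. X n w \<in> D} j) w else d)"

lemma hit_subsequence_in: "d \<in> D \<Longrightarrow> hit_subsequence D d X j w \<in> D"
  using enumerate_in_set[of "{n. X n w \<in> D}" j] by (auto simp: hit_subsequence_def)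

locale iid_sequence = prob_space M for M :: "'w measure" +
  fixes N L :: "'a measure" and X :: "nat \<Rightarrow> 'w \<Rightarrow> 'a"
  assumes indep: "indep_vars (\<lambda>_. N) X UNIV"
    and distr_eq: "\<And>n. distr M N (X n) = L"
begin

lemma measurable_X [measurable]: "X n \<in> M \<rightarrow>\<^sub>M N"
  using indep by (auto simp: indep_vars_def)

lemma sets_L: "sets L = sets N" and space_L: "space L = space N"
  using distr_eq[of 0] by auto

sublocale L: prob_space L
  using prob_space_distr[of "X 0" N] distr_eq[of 0] by simp

lemma prob_X: "A \<in> sets N \<Longrightarrow> prob (X n -` A \<inter> space M) = L.prob A"
  using measure_distr[of "X n" M N A] by (simp add: distr_eq)

lemma prob_cylinder:
  assumes "finite I" "\<And>m. m \<in> I \<Longrightarrow> B m \<in> sets N"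
  shows "prob {w \<in> space M. \<forall>m\<in>I. X m w \<in> B m} = (\<Prod>m\<in>I. L.prob (B m))"
\<comment> \<open>\<open>indep_varsD\<close> asks for a nonempty index set; for the empty one both
  sides are 1.\<close>
proof (cases "I = {}")
  case True
  then show ?thesis by (simp add: prob_space)
next
  case False
  have "{w \<in> space M. \<forall>m\<in>I. X m w \<in> B m} = (\<Inter>m\<in>I. X m -` B m \<inter> space M)"
    using False by auto
  then show ?thesis
    using indep_varsD[OF indep False assms(1), of B] assms(2) by (simp add: prob_X)
qed

section \<open>Visits to a set of positive probability\<close>

context
  fixes D :: "'a set"
  assumes D [measurable]: "D \<in> sets N" and D_pos: "L.prob D > 0"
begin

text \<open>Missing \<open>D\<close> at \<open>k\<close> given indices has probability
  \<open>(1 - L.prob D) ^ k\<close>. Letting \<open>k\<close> grow, almost surely some visit occurs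
  from index \<open>m\<close> on, and this for all of the countably many \<open>m\<close> at
  once.\<close>

lemma AE_infinite_hits: "AE w in M. infinite {n. X n w \<in> D}"
proof -
  have "AE w in M. \<exists>n\<ge>m. X n w \<in> D" for m
  proof -
    let ?Z = "{w \<in> space M. \<forall>n\<ge>m. X n w \<notin> D}"
    have Z: "?Z \<in> events"
      by measurable
    have *: "prob ?Z \<le> (1 - L.prob D) ^ k" for k
    proof -
      have "prob ?Z \<le> prob {w \<in> space M. \<forall>n\<in>{m..<m+k}. X n w \<in> space N - D}"
        by (intro finite_measure_mono) (auto dest: measurable_space[OF measurable_X])
      also have "\<dots> = (1 - L.prob D) ^ k"
        using L.prob_compl[of D] D by (subst prob_cylinder) (auto simp: sets_L space_L)
      finally show ?thesis .
    qed
    have "(\<lambda>k. (1 - L.prob D) ^ k) \<longlonglongrightarrow> 0"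
      using D_pos by (intro LIMSEQ_power_zero) (simp add: abs_less_iff L.prob_le_1 less_le_trans[OF _ L.prob_le_1])
    then have "prob ?Z \<le> 0"
      by (rule LIMSEQ_le_const) (use * in auto)
    then have "prob ?Z = 0"
      using measure_nonneg[of M ?Z] by linarith
    then have "AE w in M. w \<notin> ?Z"
      using Z by (simp add: prob_eq_0)
    with AE_space show ?thesis
      by eventually_elim auto
  qed
  then have "AE w in M. \<forall>m. \<exists>n\<ge>m. X n w \<in> D"
    by (simp add: AE_all_countable)
  then show ?thesis
    by eventually_elim (auto simp: infinite_nat_iff_unbounded_le)
qed

lemma measurable_hit_subsequence [measurable]:
  assumes "d \<in> space N"
  shows "hit_subsequence D d X j \<in> M \<rightarrow>\<^sub>M N"
proof -
  have 1 [measurable]: "(\<lambda>w. enumerate {n. X n w \<in> D} j) \<in> M \<rightarrow>\<^sub>M count_space UNIV"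
    by (rule measurable_enumerate) simp
  have 2: "(\<lambda>w. X (enumerate {n. X n w \<in> D} j) w) \<in> M \<rightarrow>\<^sub>M N"
    by (rule measurable_compose_countable[OF _ 1]) simp
  have 3: "Measurable.pred M (\<lambda>w. infinite {n. X n w \<in> D})"
    unfolding infinite_nat_iff_unbounded_le by simp
  show ?thesis
    unfolding hit_subsequence_def
    using assms 2 3 by (intro measurable_If) (auto simp: pred_def)
qed

text \<open>Fixing \<open>T\<close> makes the hit indices deterministic, so independence of the
  \<open>X n\<close> applies directly.\<close>

definition first_hits :: "nat set \<Rightarrow> (nat \<Rightarrow> 'a set) \<Rightarrow> 'w set" where
  "first_hits T A = {w \<in> space M. initial_segment {n. X n w \<in> D} T \<and>
     (\<forall>j<card T. X (enumerate T j) w \<in> A j)}"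

lemma first_hits_sets:
  assumes "\<And>j. A j \<in> sets N"
  shows "first_hits T A \<in> events"
proof -
  note [measurable] = assms
  show ?thesis
    unfolding first_hits_def initial_segment_def by measurable
qed

lemma prob_first_hits:
  assumes T: "finite T" and A: "\<And>j. A j \<in> sets N"
  shows "prob (first_hits T A) =
    (\<Prod>j<card T. L.prob (D \<inter> A j)) * (\<Prod>m\<in>(\<Union>t\<in>T. {..t}) - T. L.prob (space N - D))"
proof -
  define I where "I = (\<Union>t\<in>T. {..t})"
  have I: "finite I" "T \<subseteq> I"
    using T by (auto simp: I_def)
  \<comment> \<open>The constraint at index \<open>m\<close>: at the \<open>j\<close>-th element of
    \<open>T\<close> a hit with value in \<open>A j\<close>, elsewhere below an element of
    \<open>T\<close> a miss.\<close>
  define B where "B m = (if m \<in> T then D \<inter> A (inv_into {..<card T} (enumerate T) m)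
    else space N - D)" for m
  have bij: "bij_betw (enumerate T) {..<card T} T"
    by (rule finite_bij_enumerate[OF T])
  have inv: "inv_into {..<card T} (enumerate T) (enumerate T j) = j" if "j < card T" for j
    using bij that by (simp add: bij_betw_def)
  have T_iff: "(\<forall>j<card T. P (enumerate T j)) \<longleftrightarrow> (\<forall>m\<in>T. P m)" for P
    using bij_betw_imp_surj_on[OF bij] by (metis imageE imageI lessThan_iff)
  have B_T: "B (enumerate T j) = D \<inter> A j" if "j < card T" for j
    using that inv bij by (auto simp: B_def bij_betw_def)
  have "first_hits T A = {w \<in> space M. \<forall>m\<in>I. X m w \<in> B m}"
    unfolding first_hits_def
  proof (intro Collect_cong conj_cong[OF refl])
    fix w assume w: "w \<in> space M"
    have "(\<forall>m\<in>I. X m w \<in> B m) \<longleftrightarrow> (\<forall>m\<in>T. X m w \<in> B m) \<and> (\<forall>m\<in>I - T. X m w \<in> B m)"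
      using I by auto
    also have "(\<forall>m\<in>T. X m w \<in> B m) \<longleftrightarrow> (\<forall>j<card T. X (enumerate T j) w \<in> D \<inter> A j)"
      using T_iff[of "\<lambda>m. X m w \<in> B m"] B_T by auto
    also have "\<dots> \<longleftrightarrow> (\<forall>m\<in>T. X m w \<in> D) \<and> (\<forall>j<card T. X (enumerate T j) w \<in> A j)"
      using T_iff[of "\<lambda>m. X m w \<in> D"] by auto
    also have "(\<forall>m\<in>I - T. X m w \<in> B m) \<longleftrightarrow> (\<forall>m\<in>I - T. X m w \<notin> D)"
      using measurable_space[OF measurable_X w] by (auto simp: B_def)
    finally show "initial_segment {n. X n w \<in> D} T \<and> (\<forall>j<card T. X (enumerate T j) w \<in> A j)
        \<longleftrightarrow> (\<forall>m\<in>I. X m w \<in> B m)"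
      using I unfolding initial_segment_def I_def[symmetric] by auto
  qed
  also have "prob \<dots> = (\<Prod>m\<in>I. L.prob (B m))"
    using I A D by (intro prob_cylinder) (auto simp: B_def)
  also have "\<dots> = (\<Prod>m\<in>I - T. L.prob (B m)) * (\<Prod>m\<in>T. L.prob (B m))"
    using I by (rule prod.subset_diff[rotated])
  also have "(\<Prod>m\<in>T. L.prob (B m)) = (\<Prod>j<card T. L.prob (D \<inter> A j))"
    using B_T by (subst prod.reindex_bij_betw[OF bij, symmetric]) auto
  also have "(\<Prod>m\<in>I - T. L.prob (B m)) = (\<Prod>m\<in>I - T. L.prob (space N - D))"
    by (simp add: B_def)
  finally show ?thesis
    by (simp add: I_def mult.commute)
qed

text \<open>The factors of the misses are the same for \<open>A\<close> and for the whole space, so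
  they cancel. The remaining quotient depends on \<open>T\<close> only through its size, so it can
  be pulled out of a sum over all \<open>T\<close> of size \<open>n\<close>.\<close>

lemma prob_first_hits_factor:
  assumes T: "finite T" and A: "\<And>j. A j \<in> sets N"
  shows "prob (first_hits T A) =
    (\<Prod>j<card T. L.prob (D \<inter> A j) / L.prob D) * prob (first_hits T (\<lambda>_. space N))"
proof -
  have D_space: "D \<inter> space N = D"
    using sets.sets_into_space[OF D] by auto
  show ?thesis
    using D_pos unfolding prob_first_hits[OF T A] prob_first_hits[OF T sets.top] D_space
    by (simp add: prod_dividef)
qed

text \<open>The events that \<open>T\<close> is the set of the first \<open>n\<close> hits, for varying \<open>T\<close>, partition the space up to a null set,
  and each of them is independent of the values taken at these hits.\<close>

lemma prob_hit_subsequence: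
  assumes A: "\<And>j. A j \<in> sets N" and d: "d \<in> space N"
  shows "prob {w \<in> space M. \<forall>j<n. hit_subsequence D d X j w \<in> A j}
    = (\<Prod>j<n. L.prob (D \<inter> A j) / L.prob D)"
proof -
  define J :: "nat set set" where "J = {T. finite T \<and> card T = n}"
  define q where "q = (\<Prod>j<n. L.prob (D \<inter> A j) / L.prob D)"
  have q: "q \<ge> 0"
    unfolding q_def by (intro prod_nonneg) auto
  have J: "countable J"
    by (rule countable_subset[OF _ countable_Collect_finite]) (auto simp: J_def)
  have disj: "disjoint_family_on (\<lambda>T. first_hits T A') J" for A'
    unfolding disjoint_family_on_def
  proof (intro ballI impI)
    fix T T' assume "T \<in> J" "T' \<in> J" "T \<noteq> T'"
    then show "first_hits T A' \<inter> first_hits T' A' = {}"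
      using initial_segment_unique[of _ T T'] by (auto simp: J_def first_hits_def)
  qed
  have UN: "AE w in M. (\<forall>j<n. hit_subsequence D d X j w \<in> A' j)
      \<longleftrightarrow> w \<in> (\<Union>T\<in>J. first_hits T A')" for A'
    using AE_infinite_hits AE_space
  proof eventually_elim
    case (elim w)
    let ?H = "{n. X n w \<in> D}"
    have enum: "X (enumerate T j) w = hit_subsequence D d X j w"
      if "T \<in> J" "initial_segment ?H T" "j < n" for T j
      using enumerate_eq_if_initial_segment[of ?H T j] that elim
      by (simp add: J_def hit_subsequence_def)
    have "enumerate ?H ` {..<n} \<in> J" "initial_segment ?H (enumerate ?H ` {..<n})"
      using initial_segment_enumerate[OF elim(1)] by (auto simp: J_def)
    then show ?case
      using elim enum by (auto simp: first_hits_def J_def)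
  qed
  have meas: "{w \<in> space M. \<forall>j<n. hit_subsequence D d X j w \<in> A' j} \<in> events"
    if "\<And>j. A' j \<in> sets N" for A'
  proof -
    note [measurable] = that d
    show ?thesis by measurable
  qed
  have em: "emeasure M {w \<in> space M. \<forall>j<n. hit_subsequence D d X j w \<in> A' j}
      = (\<integral>\<^sup>+T. emeasure M (first_hits T A') \<partial>count_space J)" if A': "\<And>j. A' j \<in> sets N" for A'
  proof -
    have "emeasure M {w \<in> space M. \<forall>j<n. hit_subsequence D d X j w \<in> A' j}
        = emeasure M (\<Union>T\<in>J. first_hits T A')"
    proof (rule emeasure_eq_AE)
      show "AE w in M. w \<in> {w \<in> space M. \<forall>j<n. hit_subsequence D d X j w \<in> A' j} \<longleftrightarrow>
          w \<in> (\<Union>T\<in>J. first_hits T A')"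
        using UN[of A'] AE_space by eventually_elim auto
      show "(\<Union>T\<in>J. first_hits T A') \<in> events"
        by (intro sets.countable_UN'' J first_hits_sets A')
    qed (rule meas[OF A'])
    also have "\<dots> = (\<integral>\<^sup>+T. emeasure M (first_hits T A') \<partial>count_space J)"
      by (intro emeasure_UN_countable first_hits_sets A' J disj)
    finally show ?thesis .
  qed
  \<comment> \<open>With trivial constraints, the probabilities of the events indexed by
    \<open>T\<close> sum to 1; this leaves exactly \<open>q\<close> below.\<close>
  have one: "emeasure M {w \<in> space M. \<forall>j<n. hit_subsequence D d X j w \<in> space N} = 1"
  proof -
    have "{w \<in> space M. \<forall>j<n. hit_subsequence D d X j w \<in> space N} = space M"
      using measurable_space[OF measurable_hit_subsequence[OF d]] by auto
    then show ?thesis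
      by (simp add: emeasure_space_1)
  qed
  have "emeasure M {w \<in> space M. \<forall>j<n. hit_subsequence D d X j w \<in> A j}
      = (\<integral>\<^sup>+T. ennreal q * emeasure M (first_hits T (\<lambda>_. space N)) \<partial>count_space J)"
    unfolding em[OF A]
  proof (rule nn_integral_cong)
    fix T assume "T \<in> space (count_space J)"
    then have "prob (first_hits T A) = q * prob (first_hits T (\<lambda>_. space N))"
      using prob_first_hits_factor[of T A] A by (simp add: J_def q_def)
    then show "emeasure M (first_hits T A) = ennreal q * emeasure M (first_hits T (\<lambda>_. space N))"
      using q by (simp add: emeasure_eq_measure ennreal_mult)
  qed
  also have "\<dots> = ennreal q"
    using one em[of "\<lambda>_. space N"] by (simp add: nn_integral_cmult)
  finally show ?thesis
    using q unfolding q_def by (simp add: measure_def)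
qed

lemma prob_hit_subsequence_finite:
  assumes J: "finite J" and A: "\<And>j. j \<in> J \<Longrightarrow> A j \<in> sets N" and d: "d \<in> space N"
  shows "prob {w \<in> space M. \<forall>j\<in>J. hit_subsequence D d X j w \<in> A j}
    = (\<Prod>j\<in>J. L.prob (D \<inter> A j) / L.prob D)"
proof -
  \<comment> \<open>Padding with the whole space fills the gaps of \<open>J\<close>; the added
    factors are \<open>L.prob D / L.prob D = 1\<close>.\<close>
  define A' where "A' j = (if j \<in> J then A j else space N)" for j
  obtain n where n: "J \<subseteq> {..<n}"
    using finite_nat_iff_bounded J by auto
  have "{w \<in> space M. \<forall>j\<in>J. hit_subsequence D d X j w \<in> A j}
      = {w \<in> space M. \<forall>j<n. hit_subsequence D d X j w \<in> A' j}"
    using n measurable_space[OF measurable_hit_subsequence[OF d]] by (auto simp: A'_def)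
  also have "prob \<dots> = (\<Prod>j<n. L.prob (D \<inter> A' j) / L.prob D)"
    using A d by (intro prob_hit_subsequence) (auto simp: A'_def)
  also have "\<dots> = (\<Prod>j\<in>J. L.prob (D \<inter> A j) / L.prob D)"
    using n D_pos sets.sets_into_space[OF D]
    by (intro prod.mono_neutral_cong_right) (auto simp: A'_def Int_absorb2)
  finally show ?thesis .
qed

lemma prob_hit_subsequence_single:
  assumes "A \<in> sets N" "d \<in> space N"
  shows "prob (hit_subsequence D d X j -` A \<inter> space M) = L.prob (D \<inter> A) / L.prob D"
proof -
  have "hit_subsequence D d X j -` A \<inter> space M
      = {w \<in> space M. \<forall>k\<in>{j}. hit_subsequence D d X k w \<in> A}"
    by auto
  then show ?thesis
    using prob_hit_subsequence_finite[of "{j}" "\<lambda>_. A" d] assms by simp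
qed

text \<open>The joint probabilities are products whose factors are exactly the marginal
  probabilities.\<close>

lemma indep_vars_hit_subsequence:
  assumes d: "d \<in> space N"
  shows "indep_vars (\<lambda>_. N) (hit_subsequence D d X) UNIV"
  unfolding indep_vars_def2
proof (intro conjI ballI indep_setsI)
  fix B :: "nat \<Rightarrow> 'w set" and J :: "nat set"
  assume J: "J \<noteq> {}" "finite J"
    and "\<forall>j\<in>J. B j \<in> {hit_subsequence D d X j -` A \<inter> space M | A. A \<in> sets N}"
  then obtain A where A: "\<And>j. j \<in> J \<Longrightarrow> A j \<in> sets N"
      and B: "\<And>j. j \<in> J \<Longrightarrow> B j = hit_subsequence D d X j -` A j \<inter> space M"
    by simp metis
  have "(\<Inter>j\<in>J. B j) = {w \<in> space M. \<forall>j\<in>J. hit_subsequence D d X j w \<in> A j}"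
    using J B by auto
  then show "prob (\<Inter>j\<in>J. B j) = (\<Prod>j\<in>J. prob (B j))"
    using prob_hit_subsequence_finite[OF J(2) A d] A B d by (simp add: prob_hit_subsequence_single)
next
  fix j
  show V: "hit_subsequence D d X j \<in> M \<rightarrow>\<^sub>M N"
    by (rule measurable_hit_subsequence[OF d])
  show "{hit_subsequence D d X j -` A \<inter> space M | A. A \<in> sets N} \<subseteq> events"
    using measurable_sets[OF V] by auto
qed

end

end

section \<open>The map \<open>zeta1\<close>\<close>

context group
begin

lemma conj_by_closed [simp]:
  "i \<in> carrier G \<Longrightarrow> x \<in> carrier G \<Longrightarrow> conj_by G i x \<in> carrier G"
  by (simp add: conj_by_def)

lemma conj_by_one [simp]: "i \<in> carrier G \<Longrightarrow> conj_by G i \<one> = i"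
  by (simp add: conj_by_def)

lemma conj_by_mult:
  assumes "i \<in> carrier G" "x \<in> carrier G" "y \<in> carrier G"
  shows "conj_by G i (x \<otimes> y) = conj_by G (conj_by G i x) y"
  using assms by (simp add: conj_by_def inv_mult_group m_assoc)

text \<open>The fixed-point form of commuting, which combines with
  \<open>conj_by_mult\<close>.\<close>

lemma mem_centraliser_iff:
  assumes "i \<in> carrier G"
  shows "c \<in> centraliser G i \<longleftrightarrow> c \<in> carrier G \<and> conj_by G i c = i"
proof -
  have "inv c \<otimes> (i \<otimes> c) = i \<longleftrightarrow> c \<otimes> i = i \<otimes> c" if "c \<in> carrier G"
    using assms that inv_solve_left'[of i c "i \<otimes> c"] by auto
  then show ?thesis
    using assms by (auto simp: conj_by_def centraliser_def m_assoc)
qed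

lemma one_centraliser [simp]: "i \<in> carrier G \<Longrightarrow> \<one> \<in> centraliser G i"
  by (simp add: mem_centraliser_iff)

lemma inv_centraliser:
  assumes i: "i \<in> carrier G" and c: "c \<in> centraliser G i"
  shows "inv c \<in> centraliser G i"
proof -
  have c': "c \<in> carrier G" "conj_by G i c = i"
    using assms by (auto simp: mem_centraliser_iff)
  have "conj_by G i (inv c) = conj_by G (conj_by G i c) (inv c)"
    using c' by simp
  also have "\<dots> = i"
    using i c' conj_by_mult[of i c "inv c"] by simp
  finally show ?thesis
    using i c' by (simp add: mem_centraliser_iff)
qed

section \<open>A fixed involution: square roots and the fibres of \<open>zeta1\<close>\<close>

context
  fixes i assumes i: "involution G i"
begin

lemma involution_closed [simp]: "i \<in> carrier G"
  using i by (simp add: involution_def)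

lemma involution_square: "i \<otimes> i = \<one>"
  using i pow_ord_eq_1[of i] by (simp add: involution_def numeral_2_eq_2)

lemma involution_cancel: "x \<in> carrier G \<Longrightarrow> i \<otimes> (i \<otimes> x) = x"
  by (simp add: involution_square flip: m_assoc)

text \<open>This holds because \<open>i\<close> inverts \<open>y\<close>.\<close>

lemma conj_by_pow_commutator:
  assumes x: "x \<in> carrier G"
  defines "y \<equiv> i \<otimes> conj_by G i x"
  shows "conj_by G i (y [^] k) = i \<otimes> y [^] (2 * k :: nat)"
proof -
  have y: "y \<in> carrier G"
    using x by (simp add: y_def)
  \<comment> \<open>Equivalently, conjugation by \<open>i\<close> inverts \<open>y\<close>.\<close>
  have "y \<otimes> (i \<otimes> y) = i"
  proof -
    have "x \<otimes> (inv x \<otimes> z) = z" if "z \<in> carrier G" for z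
      using that x by (simp flip: m_assoc)
    then show ?thesis
      using x by (simp add: y_def conj_by_def m_assoc involution_cancel)
  qed
  then have inv_y: "inv y \<otimes> i = i \<otimes> y"
    using y by (simp add: inv_solve_left')
  show ?thesis
  proof (induction k)
    case (Suc k)
    have "conj_by G i (y [^] Suc k) = inv y \<otimes> (i \<otimes> y [^] (2 * k)) \<otimes> y"
      using y by (simp add: conj_by_mult Suc.IH conj_by_def[of G "_ \<otimes> _"])
    also have "\<dots> = (inv y \<otimes> i) \<otimes> (y [^] (2 * k) \<otimes> y)"
      using y by (simp add: m_assoc)
    also have "\<dots> = i \<otimes> (y \<otimes> (y [^] (2 * k) \<otimes> y))"
      using y by (simp add: inv_y m_assoc)
    also have "y \<otimes> (y [^] (2 * k) \<otimes> y) = y [^] (2 * Suc k)"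
      using y nat_pow_Suc2[of y "Suc (2 * k)"] by simp
    finally show ?case .
  qed simp
qed

lemma zeta1_dom_subset: "zeta1_dom G i \<subseteq> carrier G"
  by (auto simp: zeta1_dom_def)

text \<open>The product is \<open>i \<otimes> i = \<one>\<close>, of order 1. So the domain is
  nonempty and \<open>\<one>\<close> can serve as default value.\<close>

lemma one_zeta1_dom: "\<one> \<in> zeta1_dom G i"
  by (simp add: zeta1_dom_def involution_square)

lemma zeta1_one: "zeta1 G r i \<one> = \<one>"
  by (simp add: zeta1_def involution_square)

lemma zeta1_centraliser:
  assumes "odd r" and E: "\<And>x. x \<in> carrier G \<Longrightarrow> x [^] (2 ^ t * r) = \<one>"
    and x: "x \<in> zeta1_dom G i"
  shows "zeta1 G r i x \<in> centraliser G i"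
proof -
  define y where "y = i \<otimes> conj_by G i x"
  define u where "u = y [^] ((r + 1) div 2)"
  have x': "x \<in> carrier G" and odd: "odd (ord y)"
    using x by (auto simp: zeta1_dom_def y_def)
  have y: "y \<in> carrier G" and u: "u \<in> carrier G"
    using x' by (auto simp: y_def u_def)
  have "ord y dvd 2 ^ t * r"
    using E[OF y] y by (simp add: pow_eq_id)
  \<comment> \<open>Odd order removes the power of 2 from the exponent, leaving the odd part
    \<open>r\<close>.\<close>
  moreover have "coprime (ord y) (2 ^ t)"
    using odd by simp
  ultimately have "ord y dvd r"
    by (simp add: coprime_dvd_mult_right_iff)
  then have "y [^] r = \<one>"
    using y by (simp add: pow_eq_id)
  moreover have "2 * ((r + 1) div 2) = Suc r"
    using \<open>odd r\<close> by simp
  \<comment> \<open>Conjugating \<open>i\<close> by \<open>u\<close> gives \<open>i\<close> times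
    the power \<open>r + 1\<close> of \<open>y\<close>, which is \<open>y\<close> itself.\<close>
  ultimately have "conj_by G i u = i \<otimes> y"
    using conj_by_pow_commutator[OF x', of "(r + 1) div 2"] y by (simp add: u_def flip: y_def)
  also have "\<dots> = conj_by G i x"
    using x' by (simp add: y_def involution_cancel)
  finally have "conj_by G i (u \<otimes> inv x) = conj_by G (conj_by G i x) (inv x)"
    using x' u by (simp add: conj_by_mult)
  also have "\<dots> = i"
    using x' conj_by_mult[of i x "inv x"] by simp
  finally show ?thesis
    using x' u by (simp add: mem_centraliser_iff zeta1_def u_def y_def)
qed

lemma zeta1_mult:
  assumes c: "c \<in> centraliser G i" and x: "x \<in> carrier G"
  shows "zeta1 G r i (c \<otimes> x) = zeta1 G r i x \<otimes> inv c"
    and "c \<otimes> x \<in> zeta1_dom G i \<longleftrightarrow> x \<in> zeta1_dom G i"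
proof -
  have c': "c \<in> carrier G" "conj_by G i c = i"
    using c by (auto simp: mem_centraliser_iff)
  then have "conj_by G i (c \<otimes> x) = conj_by G i x"
    using x by (simp add: conj_by_mult)
  then show "zeta1 G r i (c \<otimes> x) = zeta1 G r i x \<otimes> inv c"
      and "c \<otimes> x \<in> zeta1_dom G i \<longleftrightarrow> x \<in> zeta1_dom G i"
    using c' x by (simp_all add: zeta1_def zeta1_dom_def inv_mult_group m_assoc)
qed

text \<open>Left multiplication by \<open>z\<close> carries the fibre over \<open>z\<close> to the
  fibre over \<open>z \<otimes> inv z = \<one>\<close>; multiplication by \<open>inv z\<close> goes
  back.\<close>

lemma card_zeta1_fibre:
  assumes z: "z \<in> centraliser G i"
  shows "card {x \<in> zeta1_dom G i. zeta1 G r i x = z} = card {x \<in> zeta1_dom G i. zeta1 G r i x = \<one>}"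
proof -
  have z': "z \<in> carrier G" and inv_z: "inv z \<in> centraliser G i"
    using z inv_centraliser[OF _ z] by (auto simp: mem_centraliser_iff)
  have cancel: "z \<otimes> (inv z \<otimes> x) = x" "inv z \<otimes> (z \<otimes> x) = x" if "x \<in> carrier G" for x
    using that z' by (simp_all flip: m_assoc)
  have "bij_betw (\<lambda>x. z \<otimes> x) {x \<in> zeta1_dom G i. zeta1 G r i x = z}
      {x \<in> zeta1_dom G i. zeta1 G r i x = \<one>}"
    using zeta1_dom_subset zeta1_mult[OF z] zeta1_mult[OF inv_z] z' cancel
    by (intro bij_betwI[where g = "\<lambda>x. inv z \<otimes> x"]) (auto simp: subset_iff)
  then show ?thesis
    by (rule bij_betw_same_card)
qed

lemma card_zeta1_vimage:
  assumes fin: "finite (carrier G)" and A: "A \<subseteq> centraliser G i"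
  shows "card {x \<in> zeta1_dom G i. zeta1 G r i x \<in> A}
    = card A * card {x \<in> zeta1_dom G i. zeta1 G r i x = \<one>}"
proof -
  have finA: "finite A"
    using A fin by (auto simp: centraliser_def intro: finite_subset)
  have "{x \<in> zeta1_dom G i. zeta1 G r i x \<in> A} = (\<Union>z\<in>A. {x \<in> zeta1_dom G i. zeta1 G r i x = z})"
    by auto
  also have "card \<dots> = (\<Sum>z\<in>A. card {x \<in> zeta1_dom G i. zeta1 G r i x = z})"
    using finA finite_subset[OF zeta1_dom_subset fin] by (intro card_UN_disjoint) auto
  also have "\<dots> = (\<Sum>z\<in>A. card {x \<in> zeta1_dom G i. zeta1 G r i x = \<one>})"
    using A by (intro sum.cong card_zeta1_fibre) auto
  also have "\<dots> = card A * card {x \<in> zeta1_dom G i. zeta1 G r i x = \<one>}"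
    by simp
  finally show ?thesis .
qed

end

end

section \<open>Law and independence of the outputs\<close>

theorem theorem6p1:
  fixes G :: "('a, 'b) monoid_scheme" and M :: "'w measure"
    and X :: "nat \<Rightarrow> 'w \<Rightarrow> 'a" and i :: 'a and E t r :: nat
  assumes "group G" and "finite (carrier G)"
    and "E > 0" and "\<And>x. x \<in> carrier G \<Longrightarrow> x [^]\<^bsub>G\<^esub> E = \<one>\<^bsub>G\<^esub>"
    and "E = 2 ^ t * r" and "odd r"
    and "involution G i"
    and "prob_space M"
    and "prob_space.indep_vars M (\<lambda>_. count_space (carrier G)) X UNIV"
    and "\<And>n. distr M (count_space (carrier G)) (X n) = uniform_count_measure (carrier G)"
  shows "zeta1 G r i \<in> zeta1_dom G i \<rightarrow> centraliser G i
    \<and> (AE w in M. infinite (hits G i X w))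
    \<and> prob_space.indep_vars M (\<lambda>_. count_space (centraliser G i)) (zeta1_output G r i X) UNIV
    \<and> (\<forall>j. distr M (count_space (centraliser G i)) (zeta1_output G r i X j)
            = uniform_count_measure (centraliser G i))"
proof -
  interpret group G by fact
  interpret iid_sequence M "count_space (carrier G)" "uniform_count_measure (carrier G)" X
    using assms by (intro iid_sequence.intro iid_sequence_axioms.intro)
  let ?D = "zeta1_dom G i" and ?C = "centraliser G i"
  let ?V = "hit_subsequence ?D \<one>\<^bsub>G\<^esub> X"
  \<comment> \<open>Off its domain \<^const>\<open>zeta1\<close> may leave the centraliser. Since \<open>f \<one> = \<one>\<close>, the identity as the default
    of the hit subsequence reproduces the default of \<^const>\<open>zeta1_output\<close>.\<close>
  define f where "f x = (if x \<in> ?D then zeta1 G r i x else \<one>\<^bsub>G\<^esub>)" for x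
  note inv = \<open>involution G i\<close> and fin = \<open>finite (carrier G)\<close>
  have D: "?D \<subseteq> carrier G" "?D \<in> sets (count_space (carrier G))" "finite ?D" "card ?D > 0"
    using zeta1_dom_subset[OF inv] one_zeta1_dom[OF inv] finite_subset fin
    by (auto simp: card_gt_0_iff)
  have C: "finite ?C" "?C \<noteq> {}"
    using fin one_centraliser[OF involution_closed[OF inv]] by (auto simp: centraliser_def)
  have G: "card (carrier G) > 0"
    using fin by (auto simp: card_gt_0_iff)
  have zeta: "zeta1 G r i x \<in> ?C" if "x \<in> ?D" for x
    using zeta1_centraliser[OF inv, of r t x] that assms by simp
  have prob_D: "L.prob ?D > 0"
    using D G fin by (simp add: measure_uniform_count_measure)
  have f: "f \<in> count_space (carrier G) \<rightarrow>\<^sub>M count_space ?C"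
    using zeta one_centraliser[OF involution_closed[OF inv]] by (auto simp: f_def)
  have out: "zeta1_output G r i X = (\<lambda>j w. f (?V j w))"
    using hit_subsequence_in[of "\<one>\<^bsub>G\<^esub>" ?D X] one_zeta1_dom[OF inv] zeta1_one[OF inv]
    by (intro ext) (auto simp: f_def zeta1_output_def hits_def hit_subsequence_def)
  have one: "\<one>\<^bsub>G\<^esub> \<in> space (count_space (carrier G))"
    by simp
  note V = measurable_hit_subsequence[OF D(2) prob_D one]
  have "AE w in M. infinite (hits G i X w)"
    using AE_infinite_hits[OF D(2) prob_D] by (simp add: hits_def)
  \<comment> \<open>Applying the same fixed map \<open>f\<close> to every term preserves
    independence.\<close>
  moreover have "indep_vars (\<lambda>_. count_space ?C) (zeta1_output G r i X) UNIV"
    unfolding out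
    by (rule indep_vars_compose2[OF indep_vars_hit_subsequence[OF D(2) prob_D one]]) (rule f)
  moreover have "distr M (count_space ?C) (zeta1_output G r i X j) = uniform_count_measure ?C" for j
  proof (rule measure_eqI)
    fix A assume "A \<in> sets (distr M (count_space ?C) (zeta1_output G r i X j))"
    then have A: "A \<subseteq> ?C"
      by simp
    \<comment> \<open>The common fibre size: \<open>?D\<close> has \<open>card ?C * m\<close>
      elements and the preimage of \<open>A\<close> in it has \<open>card A * m\<close>.\<close>
    define m where "m = card {x \<in> ?D. zeta1 G r i x = \<one>\<^bsub>G\<^esub>}"
    have "{x \<in> ?D. zeta1 G r i x \<in> ?C} = ?D"
      using zeta by auto
    then have card_D: "card ?D = card ?C * m"
      using card_zeta1_vimage[OF inv fin subset_refl, of r] by (simp add: m_def)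
    have card_A: "card (?D \<inter> (f -` A \<inter> carrier G)) = card A * m"
    proof -
      have "?D \<inter> (f -` A \<inter> carrier G) = {x \<in> ?D. zeta1 G r i x \<in> A}"
        using D(1) by (auto simp: f_def)
      then show ?thesis
        using card_zeta1_vimage[OF inv fin A] by (simp add: m_def)
    qed
    have "emeasure (distr M (count_space ?C) (zeta1_output G r i X j)) A
        = emeasure M (?V j -` (f -` A \<inter> carrier G) \<inter> space M)"
    proof -
      have "(\<lambda>w. f (?V j w)) -` A \<inter> space M = ?V j -` (f -` A \<inter> carrier G) \<inter> space M"
        using measurable_space[OF V] by auto
      then show ?thesis
        using A measurable_compose[OF V f] by (simp add: out emeasure_distr)
    qed
    also have "\<dots> = ennreal (L.prob (?D \<inter> (f -` A \<inter> carrier G)) / L.prob ?D)"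
      using prob_hit_subsequence_single[OF D(2) prob_D _ one, of "f -` A \<inter> carrier G"]
      by (simp add: emeasure_eq_measure)
    also have "L.prob (?D \<inter> (f -` A \<inter> carrier G)) / L.prob ?D = card A / card ?C"
    proof -
      have "L.prob (?D \<inter> (f -` A \<inter> carrier G)) = card A * m / card (carrier G)"
        using fin card_A by (subst measure_uniform_count_measure) auto
      moreover have "L.prob ?D = card ?C * m / card (carrier G)"
        using fin D card_D by (subst measure_uniform_count_measure) auto
      \<comment> \<open>Since \<open>?D\<close> is nonempty, \<open>m\<close> is positive and
        cancels together with the order of the group.\<close>
      ultimately show ?thesis
        using D(4) G card_D by simp
    qed
    finally show "emeasure (distr M (count_space ?C) (zeta1_output G r i X j)) A
        = emeasure (uniform_count_measure ?C) A"
      using A C by (simp add: emeasure_uniform_count_measure)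
  qed (simp add: sets_uniform_count_measure)
  ultimately show ?thesis
    using zeta by auto
qed

end
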